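(* Let $n\geq 2$ and $m\geq 1$ be integers and let $B_{n,m}=\{(i,j): i\in[n],\ j\in[m]\}$. (1) Let $d$ be the minimal nonnegative integer such that every linear order on $B_{n,m}$ is induced by the pairwise distances between two point collections $P=(p_1,\dots,p_n)$ and $Q=(q_1,\dots,q_m)$ in $\mathbb{R}^d$. Then $\min(n,m)-1\leq d\leq \min(n,m)$. (2) The minimal nonnegative integer $d$ such that every total preorder on $B_{n,m}$ is induced by the pairwise distances between two point collections $P=(p_1,\dots,p_n)$ and $Q=(q_1,\dots,q_m)$ in $\mathbb{R}^d$ is $d=\min(n,m)$.
   Context: $[k]=\{1,\dots,k\}$. A total preorder is a reflexive, transitive relation in which any two elements are comparable; a linear order is an antisymmetric total preorder. Let $P=(p_1,\dots,p_n)$ and $Q=(q_1,\dots,q_m)$ be collections (indexed families) of points in $\mathbb{R}^d$ with the Euclidean norm. Repeated points are allowed within $P$ and within $Q$, but every point of $P$ is required to be distinct from every point of $Q$. The pair $(P,Q)$ induces the total preorder $\leq$ on $B_{n,m}$ given by: $(i_1,i_2)\leq (j_1,j_2)$ if and only if $\|p_{i_1}-q_{i_2}\|\leq\|p_{j_1}-q_{j_2}\|$. A given total preorder (or linear order) on $B_{n,m}$ is induced by $(P,Q)$ if it coincides with this relation. *)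

theory Defs
  imports "HOL-Analysis.Analysis"
begin

text \<open>
  The dimension \<open>d\<close> is quantified inside the statement, so \<open>\<real>\<^sup>d\<close> cannot be indexed by a type.
  It is rendered as \<open>topspace (Euclidean_space d)\<close>, the sequences of reals whose
  coordinates with index \<open>\<ge> d\<close> vanish. Equality of such sequences is thus
  equality of points of \<open>\<real>\<^sup>d\<close>.
\<close>

definition eucl_dist :: "nat \<Rightarrow> (nat \<Rightarrow> real) \<Rightarrow> (nat \<Rightarrow> real) \<Rightarrow> real" where
  "eucl_dist d x y = L2_set (\<lambda>k. x k - y k) {..<d}"

definition index_set :: "nat \<Rightarrow> nat \<Rightarrow> (nat \<times> nat) set" where
  "index_set n m = {1..n} \<times> {1..m}"

definition total_preorder_on :: "'a set \<Rightarrow> 'a rel \<Rightarrow> bool" where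
  "total_preorder_on A r \<longleftrightarrow> preorder_on A r \<and> total_on A r"

definition point_collections ::
  "nat \<Rightarrow> nat \<Rightarrow> nat \<Rightarrow> (nat \<Rightarrow> nat \<Rightarrow> real) \<Rightarrow> (nat \<Rightarrow> nat \<Rightarrow> real) \<Rightarrow> bool" where
  "point_collections d n m p q \<longleftrightarrow>
     (\<forall>i\<in>{1..n}. p i \<in> topspace (Euclidean_space d)) \<and>
     (\<forall>j\<in>{1..m}. q j \<in> topspace (Euclidean_space d)) \<and>
     (\<forall>i\<in>{1..n}. \<forall>j\<in>{1..m}. p i \<noteq> q j)"

definition distance_preorder ::
  "nat \<Rightarrow> nat \<Rightarrow> nat \<Rightarrow> (nat \<Rightarrow> nat \<Rightarrow> real) \<Rightarrow> (nat \<Rightarrow> nat \<Rightarrow> real) \<Rightarrow> (nat \<times> nat) rel" where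
  "distance_preorder d n m p q =
     {((i1, i2), (j1, j2)). (i1, i2) \<in> index_set n m \<and> (j1, j2) \<in> index_set n m \<and>
        eucl_dist d (p i1) (q i2) \<le> eucl_dist d (p j1) (q j2)}"

definition induced_in_dim :: "nat \<Rightarrow> nat \<Rightarrow> nat \<Rightarrow> (nat \<times> nat) rel \<Rightarrow> bool" where
  "induced_in_dim d n m r \<longleftrightarrow>
     (\<exists>p q. point_collections d n m p q \<and> r = distance_preorder d n m p q)"

definition all_linear_orders_induced :: "nat \<Rightarrow> nat \<Rightarrow> nat \<Rightarrow> bool" where
  "all_linear_orders_induced n m d \<longleftrightarrow>
     (\<forall>r. linear_order_on (index_set n m) r \<longrightarrow> induced_in_dim d n m r)"

definition all_total_preorders_induced :: "nat \<Rightarrow> nat \<Rightarrow> nat \<Rightarrow> bool" where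
  "all_total_preorders_induced n m d \<longleftrightarrow>
     (\<forall>r. total_preorder_on (index_set n m) r \<longrightarrow> induced_in_dim d n m r)"

end

theory Submission
  imports Defs
begin

text \<open>
  Write \<open>k\<close> for the minimum of \<open>n\<close> and \<open>m\<close>.

  Upper bounds. By exchanging \<open>P\<close> and \<open>Q\<close> one may assume that \<open>P\<close> has \<open>k\<close> points. Place them at the
  standard basis vectors of \<open>\<real>\<^sup>k\<close>. The squared distances from a point \<open>x\<close> to these \<open>k\<close> points can be
  prescribed arbitrarily near \<open>1\<close>: the \<open>i\<close>-th one is \<open>\<bar>x\<bar>\<^sup>2 - 2 x\<^sub>i + 1\<close>, so the coordinates of \<open>x\<close>
  are determined by the target values and \<open>s = \<bar>x\<bar>\<^sup>2\<close>, and consistency is a quadratic equation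
  for \<open>s\<close> whose discriminant is positive (\<open>basis_distances_prescribable\<close>). Each point of \<open>Q\<close> is chosen independently, with
  squared distances \<open>1\<close> plus a small multiple of the rank of the entry in the given preorder.

  Lower bounds. If \<open>\<Sum> c\<^sub>i (p\<^sub>i - o) = 0\<close>, then for every point \<open>x\<close> the weighted sum
  \<open>\<Sum> c\<^sub>i \<bar>p\<^sub>i - x\<bar>\<^sup>2\<close> equals \<open>\<Sum> c\<^sub>i \<bar>p\<^sub>i - o\<bar>\<^sup>2 + (\<Sum> c\<^sub>i) \<bar>x - o\<bar>\<^sup>2\<close> (\<open>weighted_sq_dist\<close>). In low
  dimension such weights exist, and a suitable order contradicts this identity.

  For linear orders, let the \<open>j\<close>-th column of the distance matrix increase along the cyclic
  order \<open>j, j+1, \<dots>, k, 1, \<dots>, j-1\<close> of the rows. If \<open>d < k - 1\<close>, then \<open>p\<^sub>1, \<dots>, p\<^sub>k\<close> are affinely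
  dependent, so there are weights of sum \<open>0\<close>, and then the weighted column sum does not depend on the
  column. But by the cycle lemma some cyclic shift of the weights has only nonnegative partial
  sums and another one only nonpositive partial sums; summation by parts turns these into a
  negative and a positive column sum (\<open>cyclic_order_needs_dim\<close>).

  For preorders, let all entries be equal except for the smaller entries \<open>(i, i)\<close> with \<open>i < k\<close>. Then
  \<open>p\<^sub>1, \<dots>, p\<^sub>k\<close> lie on a sphere about \<open>q\<^sub>k\<close>. If \<open>d < k\<close>, the radius vectors \<open>p\<^sub>i - q\<^sub>k\<close> are linearly
  dependent. The identity at \<open>q\<^sub>j\<close> with \<open>j < k\<close> says that \<open>c\<^sub>j\<close> never has the sign of
  \<open>\<Sum> c\<^sub>i\<close>, and then the identity at \<open>p\<^sub>k\<close> is violated (\<open>broken_diagonal_needs_dim\<close>).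
\<close>

section \<open>Squared distances and linear dependence\<close>

definition sq_dist :: "nat \<Rightarrow> (nat \<Rightarrow> real) \<Rightarrow> (nat \<Rightarrow> real) \<Rightarrow> real" where
  "sq_dist d x y = (\<Sum>l<d. (x l - y l)\<^sup>2)"

lemma eucl_dist_eq_sqrt: "eucl_dist d x y = sqrt (sq_dist d x y)"
  by (simp add: eucl_dist_def L2_set_def sq_dist_def)

lemma sq_dist_commute: "sq_dist d x y = sq_dist d y x"
  by (simp add: sq_dist_def power2_commute)

lemma sq_dist_self [simp]: "sq_dist d x x = 0"
  by (simp add: sq_dist_def)

lemma sq_dist_nonneg: "0 \<le> sq_dist d x y"
  by (simp add: sq_dist_def sum_nonneg)

lemma sq_dist_pos:
  assumes "x \<in> topspace (Euclidean_space d)" "y \<in> topspace (Euclidean_space d)" "x \<noteq> y"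
  shows "0 < sq_dist d x y"
proof -
  obtain l where l: "x l \<noteq> y l"
    using assms(3) by blast
  have "l < d"
    using assms(1,2) l by (force simp: topspace_Euclidean_space not_less[symmetric])
  then show ?thesis
    unfolding sq_dist_def using l by (intro sum_pos2[of _ l]) auto
qed

text \<open>
  The parallel axis identity: the cross terms of \<open>\<bar>(p\<^sub>i - z) - (x - z)\<bar>\<^sup>2\<close> cancel because
  the weighted sum of the vectors \<open>p\<^sub>i - z\<close> vanishes.
\<close>

lemma weighted_sq_dist:
  assumes "\<And>l. l < d \<Longrightarrow> (\<Sum>i\<in>I. c i * (p i l - z l)) = 0"
  shows "(\<Sum>i\<in>I. c i * sq_dist d (p i) x) =
         (\<Sum>i\<in>I. c i * sq_dist d (p i) z) + (\<Sum>i\<in>I. c i) * sq_dist d x z"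
proof -
  have coord: "(\<Sum>i\<in>I. c i * (p i l - x l)\<^sup>2) =
      (\<Sum>i\<in>I. c i * (p i l - z l)\<^sup>2) + (\<Sum>i\<in>I. c i) * (x l - z l)\<^sup>2" if "l < d" for l
  proof -
    have "(\<Sum>i\<in>I. c i * (p i l - x l)\<^sup>2) =
        (\<Sum>i\<in>I. c i * (p i l - z l)\<^sup>2 + c i * (x l - z l)\<^sup>2
          - 2 * (x l - z l) * (c i * (p i l - z l)))"
      by (intro sum.cong) (auto simp: power2_eq_square algebra_simps)
    also have "\<dots> = (\<Sum>i\<in>I. c i * (p i l - z l)\<^sup>2) + (\<Sum>i\<in>I. c i) * (x l - z l)\<^sup>2
        - 2 * (x l - z l) * (\<Sum>i\<in>I. c i * (p i l - z l))"
      by (simp add: sum.distrib sum_subtractf sum_distrib_left sum_distrib_right)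
    finally show ?thesis
      using assms[OF that] by simp
  qed
  have swap: "(\<Sum>i\<in>I. c i * sq_dist d (p i) y) = (\<Sum>l<d. \<Sum>i\<in>I. c i * (p i l - y l)\<^sup>2)" for y
    unfolding sq_dist_def by (simp add: sum_distrib_left) (rule sum.swap)
  show ?thesis
    unfolding swap by (simp add: coord sum.distrib sq_dist_def sum_distrib_left)
qed

text \<open>
  A homogeneous linear system with more unknowns than equations, by elimination: one unknown
  is used to solve the last equation and is substituted into the others.
\<close>

lemma exists_linear_dependence:
  fixes v :: "'i \<Rightarrow> nat \<Rightarrow> real"
  assumes "finite I" "d < card I"
  shows "\<exists>c. (\<exists>i\<in>I. c i \<noteq> 0) \<and> (\<forall>l<d. (\<Sum>i\<in>I. c i * v i l) = 0)"
  using assms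
proof (induction d arbitrary: I v)
  case 0
  then have "I \<noteq> {}" by auto
  then show ?case by (auto intro: exI[of _ "\<lambda>_. 1"])
next
  case (Suc d)
  show ?case
  proof (cases "\<forall>i\<in>I. v i d = 0")
    case True
    obtain c where "\<exists>i\<in>I. c i \<noteq> 0" "\<forall>l<d. (\<Sum>i\<in>I. c i * v i l) = 0"
      using Suc.IH[of I v] Suc.prems by auto
    then show ?thesis
      using True by (auto simp: less_Suc_eq)
  next
    case False
    then obtain e where e: "e \<in> I" "v e d \<noteq> 0" by blast
    define J where "J = I - {e}"
    define w where "w = (\<lambda>i l. v i l - v i d / v e d * v e l)"
    have J: "finite J" "d < card J"
      using Suc.prems e by (auto simp: J_def)
    obtain c where c: "\<exists>i\<in>J. c i \<noteq> 0" "\<forall>l<d. (\<Sum>i\<in>J. c i * w i l) = 0"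
      using Suc.IH[OF J, of w] by auto
    define c' where "c' = c(e := - (\<Sum>i\<in>J. c i * v i d) / v e d)"
    have c'_J: "c' i = c i" if "i \<in> J" for i
      using that by (auto simp: c'_def J_def)
    have total: "(\<Sum>i\<in>I. c' i * v i l) = (\<Sum>i\<in>J. c i * w i l)" for l
    proof -
      have "(\<Sum>i\<in>I. c' i * v i l) = c' e * v e l + (\<Sum>i\<in>J. c i * v i l)"
        using e Suc.prems by (simp add: sum.remove[of I e] J_def[symmetric] c'_J)
      also have "\<dots> = (\<Sum>i\<in>J. c i * w i l)"
        by (simp add: c'_def w_def algebra_simps sum_subtractf sum_divide_distrib sum_distrib_left)
      finally show ?thesis .
    qed
    have "(\<Sum>i\<in>I. c' i * v i l) = 0" if "l < Suc d" for l
      using that c(2) e unfolding total by (auto simp: less_Suc_eq w_def)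
    moreover have "\<exists>i\<in>I. c' i \<noteq> 0"
      using c(1) c'_J by (metis Diff_subset J_def subsetD)
    ultimately show ?thesis by blast
  qed
qed

section \<open>Cyclically ordered columns\<close>

text \<open>
  The free constant \<open>M\<close> serves to measure the partial sums from their minimum, so that all
  coefficients of the differences become nonnegative.
\<close>

lemma summation_by_parts:
  fixes c D :: "nat \<Rightarrow> real"
  shows "(\<Sum>i=1..k. c i * D i) =
         (\<Sum>i=1..k. ((\<Sum>h=1..i. c h) - M) * (D i - D (Suc i)))
           + ((\<Sum>h=1..k. c h) - M) * D (Suc k) + M * D 1"
  by (induction k) (simp_all add: algebra_simps)

text \<open>
  The cycle lemma: the shift by \<open>j\<close> is chosen so that the partial sums up to \<open>j - 1\<close> attain their
  minimum. Then all partial sums of the weights, taken in the cyclic order starting at \<open>j\<close>, are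
  nonnegative, and summation by parts against a sequence that increases along this cyclic order
  gives a negative value.
\<close>

lemma exists_shift_weighted_sum_neg:
  fixes c :: "nat \<Rightarrow> real"
  assumes sum0: "(\<Sum>i=1..k. c i) = 0" and nz: "\<exists>i\<in>{1..k}. c i \<noteq> 0"
  obtains j where "j \<in> {1..k}"
    and "\<And>D :: nat \<Rightarrow> real. (\<And>i. i \<in> {1..<k} \<Longrightarrow> Suc i \<noteq> j \<Longrightarrow> D i < D (Suc i)) \<Longrightarrow>
           (j \<noteq> 1 \<Longrightarrow> D k < D 1) \<Longrightarrow> (\<Sum>i=1..k. c i * D i) < 0"
proof -
  define S where "S = (\<lambda>t. \<Sum>i=1..t. c i)"
  have S0: "S 0 = 0" and Sk: "S k = 0"
    using sum0 by (simp_all add: S_def)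
  have "k \<ge> 1" using nz by auto
  obtain t where t: "t < k" and t_min: "\<And>u. u < k \<Longrightarrow> S t \<le> S u"
  proof -
    have "finite (S ` {..<k})" "S ` {..<k} \<noteq> {}"
      using \<open>k \<ge> 1\<close> by (auto simp: lessThan_empty_iff)
    then have "Min (S ` {..<k}) \<in> S ` {..<k}" "\<And>u. u < k \<Longrightarrow> Min (S ` {..<k}) \<le> S u"
      by auto
    then show ?thesis using that by (metis imageE lessThan_iff)
  qed
  have min: "S t \<le> S i" if "i \<in> {1..k}" for i
    using that t_min[of i] t_min[of 0] \<open>k \<ge> 1\<close> S0 Sk by (cases "i = k") auto
  have some: "\<exists>i\<in>{1..k}. S t < S i"
  proof (rule ccontr)
    assume "\<not> ?thesis"
    then have eq: "S i = S t" if "i \<in> {1..k}" for i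
      using that min[OF that] by force
    have zero: "S i = 0" if "i \<le> k" for i
      using eq[of i] eq[of k] that \<open>k \<ge> 1\<close> S0 Sk by (cases "i = 0") auto
    have "c i = 0" if "i \<in> {1..k}" for i
    proof -
      obtain h where h: "i = Suc h" using \<open>i \<in> {1..k}\<close> by (cases i) auto
      have "S (Suc h) = S h + c (Suc h)" by (simp add: S_def)
      then show ?thesis using zero[of h] zero[of "Suc h"] h that by auto
    qed
    then show False using nz by blast
  qed
  show thesis
  proof (rule that[of "Suc t"])
    show "Suc t \<in> {1..k}" using t by simp
    fix D :: "nat \<Rightarrow> real"
    assume step: "\<And>i. i \<in> {1..<k} \<Longrightarrow> Suc i \<noteq> Suc t \<Longrightarrow> D i < D (Suc i)"
      and wrap: "Suc t \<noteq> 1 \<Longrightarrow> D k < D 1"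
    \<comment> \<open>Closing \<open>D\<close> up at \<open>k + 1\<close> makes the boundary terms of the summation cancel.\<close>
    define E where "E = D(Suc k := D 1)"
    have sum_eq: "(\<Sum>i=1..k. c i * D i) = (\<Sum>i=1..k. (S i - S t) * (E i - E (Suc i)))"
    proof -
      have "(\<Sum>i=1..k. c i * D i) = (\<Sum>i=1..k. c i * E i)"
        by (intro sum.cong) (auto simp: E_def)
      also have "\<dots> = (\<Sum>i=1..k. (S i - S t) * (E i - E (Suc i)))
          + (S k - S t) * E (Suc k) + S t * E 1"
        unfolding S_def by (rule summation_by_parts)
      also have "\<dots> = (\<Sum>i=1..k. (S i - S t) * (E i - E (Suc i)))"
        using \<open>k \<ge> 1\<close> Sk by (simp add: E_def)
      finally show ?thesis .
    qed
    have E_step: "E i < E (Suc i)" if "i \<in> {1..k}" "S t < S i" for i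
    proof (cases "i = k")
      case True
      then have "t \<noteq> 0" using that S0 Sk by (cases "t = 0") auto
      then show ?thesis using True wrap t by (simp add: E_def)
    next
      case False
      then show ?thesis using that step[of i] by (auto simp: E_def)
    qed
    have "(\<Sum>i=1..k. (S i - S t) * (E i - E (Suc i))) < (\<Sum>i=1..k. 0)"
    proof (rule sum_strict_mono_ex1)
      show "\<forall>i\<in>{1..k}. (S i - S t) * (E i - E (Suc i)) \<le> 0"
      proof
        fix i assume i: "i \<in> {1..k}"
        show "(S i - S t) * (E i - E (Suc i)) \<le> 0"
          using min[OF i] E_step[OF i] by (cases "S i = S t") (auto simp: mult_le_0_iff)
      qed
      show "\<exists>i\<in>{1..k}. (S i - S t) * (E i - E (Suc i)) < 0"
        using some E_step by (meson diff_gt_0_iff_gt diff_less_0_iff_less mult_pos_neg)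
    qed simp
    then show "(\<Sum>i=1..k. c i * D i) < 0" using sum_eq by simp
  qed
qed

text \<open>
  An affine dependence of \<open>p\<^sub>1, \<dots>, p\<^sub>k\<close> makes all weighted column sums equal, whereas the cycle
  lemma, applied to the weights and to their negatives, gives two columns with sums of opposite signs.
\<close>

lemma cyclic_order_needs_dim:
  assumes step: "\<And>i j. i \<in> {1..<k} \<Longrightarrow> j \<in> {1..k} \<Longrightarrow> Suc i \<noteq> j \<Longrightarrow>
      sq_dist d (p i) (q j) < sq_dist d (p (Suc i)) (q j)"
    and wrap: "\<And>j. j \<in> {1..k} \<Longrightarrow> j \<noteq> 1 \<Longrightarrow> sq_dist d (p k) (q j) < sq_dist d (p 1) (q j)"
  shows "k - 1 \<le> d"
proof (rule ccontr)
  assume "\<not> ?thesis"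
  then have card: "Suc d < card {1..k}" by simp
  \<comment> \<open>A constant extra coordinate encodes the condition that the weights sum to \<open>0\<close>.\<close>
  obtain c where nz: "\<exists>i\<in>{1..k}. c i \<noteq> 0"
    and dep: "\<forall>l<Suc d. (\<Sum>i=1..k. c i * (if l = d then 1 else p i l)) = 0"
    using exists_linear_dependence[OF _ card, of "\<lambda>i l. if l = d then 1 else p i l"]
    by blast
  have sum0: "(\<Sum>i=1..k. c i) = 0"
    using dep[rule_format, of d] by simp
  have coord: "(\<Sum>i=1..k. c i * p i l) = 0" if "l < d" for l
    using dep[rule_format, of l] that by simp
  have column: "(\<Sum>i=1..k. c i * sq_dist d (p i) x) = (\<Sum>i=1..k. c i * sq_dist d (p i) (\<lambda>_. 0))" for x
    using weighted_sq_dist[of d c p "\<lambda>_. 0" "{1..k}" x] coord sum0 by simp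
  obtain j where j: "j \<in> {1..k}" "(\<Sum>i=1..k. c i * sq_dist d (p i) (q j)) < 0"
  proof (rule exists_shift_weighted_sum_neg[OF sum0 nz])
    fix j assume j: "j \<in> {1..k}"
      and "\<And>D :: nat \<Rightarrow> real. (\<And>i. i \<in> {1..<k} \<Longrightarrow> Suc i \<noteq> j \<Longrightarrow> D i < D (Suc i)) \<Longrightarrow>
           (j \<noteq> 1 \<Longrightarrow> D k < D 1) \<Longrightarrow> (\<Sum>i=1..k. c i * D i) < 0"
    from this(2)[of "\<lambda>i. sq_dist d (p i) (q j)"] show thesis
      using that j step[OF _ j] wrap[OF j] by blast
  qed
  have "(\<Sum>i=1..k. - c i) = 0" "\<exists>i\<in>{1..k}. - c i \<noteq> 0"
    using sum0 nz by (simp_all add: sum_negf)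
  then obtain j' where j': "j' \<in> {1..k}" "(\<Sum>i=1..k. - c i * sq_dist d (p i) (q j')) < 0"
  proof (rule exists_shift_weighted_sum_neg)
    fix j assume j: "j \<in> {1..k}"
      and "\<And>D :: nat \<Rightarrow> real. (\<And>i. i \<in> {1..<k} \<Longrightarrow> Suc i \<noteq> j \<Longrightarrow> D i < D (Suc i)) \<Longrightarrow>
           (j \<noteq> 1 \<Longrightarrow> D k < D 1) \<Longrightarrow> (\<Sum>i=1..k. - c i * D i) < 0"
    from this(2)[of "\<lambda>i. sq_dist d (p i) (q j)"] show thesis
      using that j step[OF _ j] wrap[OF j] by blast
  qed
  show False
    using j(2) j'(2) column[of "q j"] column[of "q j'"] by (simp add: sum_negf)
qed

section \<open>Cospherical points\<close>

text \<open>
  Let \<open>s\<close> be the sum of the weights of a linear dependence of the radius vectors \<open>p\<^sub>i - q\<^sub>k\<close>, with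
  \<open>s \<ge> 0\<close> after a change of sign. The weighted sum of column \<open>j\<close> is \<open>s a\<close> minus a positive multiple
  of \<open>c\<^sub>j\<close>, and also at least \<open>s a\<close>; hence \<open>c\<^sub>j \<le> 0\<close> for \<open>j < k\<close>. The weighted sum of the squared
  distances to \<open>p\<^sub>k\<close> is therefore nonpositive, although it equals \<open>2 s a\<close>. This is positive, as
  \<open>s = 0\<close> would make all weights vanish.
\<close>

lemma broken_diagonal_needs_dim:
  assumes "1 \<le> k" and a: "0 < a"
    and off: "\<And>i j. i \<in> {1..k} \<Longrightarrow> j \<in> {1..k} \<Longrightarrow> i \<noteq> j \<or> j = k \<Longrightarrow> sq_dist d (p i) (q j) = a"
    and diag: "\<And>j. j \<in> {1..<k} \<Longrightarrow> sq_dist d (p j) (q j) < a"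
  shows "k \<le> d"
proof (rule ccontr)
  assume "\<not> ?thesis"
  then obtain c0 where nz0: "\<exists>i\<in>{1..k}. c0 i \<noteq> 0"
    and dep0: "\<forall>l<d. (\<Sum>i=1..k. c0 i * (p i l - q k l)) = 0"
    using exists_linear_dependence[of "{1..k}" d "\<lambda>i l. p i l - q k l"] by auto
  obtain c where nz: "\<exists>i\<in>{1..k}. c i \<noteq> 0"
    and dep: "\<And>l. l < d \<Longrightarrow> (\<Sum>i=1..k. c i * (p i l - q k l)) = 0"
    and nonneg: "0 \<le> (\<Sum>i=1..k. c i)"
  proof (cases "0 \<le> (\<Sum>i=1..k. c0 i)")
    case True
    then show ?thesis using that nz0 dep0 by blast
  next
    case False
    show ?thesis
      using that[of "\<lambda>i. - c0 i"] nz0 dep0 False by (simp add: sum_negf)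
  qed
  define s where "s = (\<Sum>i=1..k. c i)"
  have radius: "(\<Sum>i=1..k. c i * sq_dist d (p i) (q k)) = s * a"
    unfolding s_def sum_distrib_right using off by (intro sum.cong) (use \<open>1 \<le> k\<close> in auto)
  have weighted: "(\<Sum>i=1..k. c i * sq_dist d (p i) x) = s * a + s * sq_dist d x (q k)" for x
    using weighted_sq_dist[of d c p "q k" "{1..k}" x] dep radius by (simp add: s_def)
  have c_j: "c j * (a - sq_dist d (p j) (q j)) = - s * sq_dist d (q j) (q k)" if j: "j \<in> {1..<k}" for j
  proof -
    have jk: "j \<in> {1..k}" using j by auto
    have "(\<Sum>i=1..k. c i * sq_dist d (p i) (q j))
        = (\<Sum>i=1..k. c i * a - (if i = j then c j * (a - sq_dist d (p j) (q j)) else 0))"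
      using off[OF _ jk] by (intro sum.cong) (auto simp: algebra_simps)
    also have "\<dots> = s * a - c j * (a - sq_dist d (p j) (q j))"
      using jk by (simp add: sum_subtractf s_def sum_distrib_right)
    finally show ?thesis using weighted[of "q j"] by simp
  qed
  have nonpos: "c j \<le> 0" if j: "j \<in> {1..<k}" for j
  proof -
    have "c j * (a - sq_dist d (p j) (q j)) \<le> 0"
      using c_j[OF j] nonneg sq_dist_nonneg[of d "q j" "q k"] by (simp add: s_def)
    then show ?thesis using diag[OF j] by (simp add: mult_le_0_iff)
  qed
  have split_last: "(\<Sum>i=1..k. f i) = (\<Sum>i\<in>{1..<k}. f i) + f k" for f :: "nat \<Rightarrow> real"
    using \<open>1 \<le> k\<close> by (simp add: sum.last_plus)
  have "s \<noteq> 0"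
  proof
    assume "s = 0"
    then have zero: "c j = 0" if "j \<in> {1..<k}" for j
      using c_j[OF that] diag[OF that] by auto
    then have "c k = 0"
      using \<open>s = 0\<close> split_last[of c] by (simp add: s_def)
    then have "c i = 0" if "i \<in> {1..k}" for i
      using zero[of i] that by (cases "i = k") auto
    then show False using nz by blast
  qed
  then have "0 < s" using nonneg by (simp add: s_def)
  have "sq_dist d (p k) (q k) = a"
    using off[of k k] \<open>1 \<le> k\<close> by simp
  then have "(\<Sum>i=1..k. c i * sq_dist d (p i) (p k)) = 2 * (s * a)"
    using weighted[of "p k"] by simp
  moreover have "(\<Sum>i=1..k. c i * sq_dist d (p i) (p k)) \<le> 0"
    unfolding split_last using nonpos
    by (auto intro!: sum_nonpos mult_nonpos_nonneg sq_dist_nonneg)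
  ultimately show False
    using mult_pos_pos[OF \<open>0 < s\<close> a] by linarith
qed

section \<open>Orders that need many dimensions\<close>

definition key_order :: "'a set \<Rightarrow> ('a \<Rightarrow> nat) \<Rightarrow> 'a rel" where
  "key_order A f = {(x, y). x \<in> A \<and> y \<in> A \<and> f x \<le> f y}"

lemma total_preorder_on_key_order: "total_preorder_on A (key_order A f)"
  by (auto simp: total_preorder_on_def preorder_on_def refl_on_def total_on_def trans_def key_order_def)

lemma linear_order_on_key_order: "inj_on f A \<Longrightarrow> linear_order_on A (key_order A f)"
  by (auto simp: linear_order_on_def partial_order_on_def preorder_on_def refl_on_def total_on_def
      trans_def antisym_def key_order_def inj_on_def)

lemma induced_key_orderE:
  assumes "induced_in_dim d n m (key_order (index_set n m) f)"
  obtains p q where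
    "\<And>i j i' j'. i \<in> {1..n} \<Longrightarrow> j \<in> {1..m} \<Longrightarrow> i' \<in> {1..n} \<Longrightarrow> j' \<in> {1..m} \<Longrightarrow>
       sq_dist d (p i) (q j) \<le> sq_dist d (p i') (q j') \<longleftrightarrow> f (i, j) \<le> f (i', j')"
    "\<And>i j. i \<in> {1..n} \<Longrightarrow> j \<in> {1..m} \<Longrightarrow> 0 < sq_dist d (p i) (q j)"
proof -
  obtain p q where pq: "point_collections d n m p q"
    and eq: "key_order (index_set n m) f = distance_preorder d n m p q"
    using assms by (auto simp: induced_in_dim_def)
  show thesis
  proof (rule that)
    fix i j i' j' assume "i \<in> {1..n}" "j \<in> {1..m}" "i' \<in> {1..n}" "j' \<in> {1..m}"
    then show "sq_dist d (p i) (q j) \<le> sq_dist d (p i') (q j') \<longleftrightarrow> f (i, j) \<le> f (i', j')"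
      using arg_cong[OF eq, of "\<lambda>r. ((i, j), (i', j')) \<in> r"]
      by (simp add: key_order_def distance_preorder_def index_set_def eucl_dist_eq_sqrt)
  next
    fix i j assume "i \<in> {1..n}" "j \<in> {1..m}"
    then show "0 < sq_dist d (p i) (q j)"
      using pq by (auto simp: point_collections_def intro!: sq_dist_pos)
  qed
qed

text \<open>
  Entries are compared by column first. Within column \<open>j\<close> the rows \<open>1, \<dots>, j - 1\<close> are moved behind
  row \<open>n\<close>, which gives the cyclic order starting at \<open>j\<close> on all rows, hence also on the first \<open>k\<close> ones.
\<close>

definition cyclic_key :: "nat \<Rightarrow> nat \<times> nat \<Rightarrow> nat" where
  "cyclic_key n = (\<lambda>(i, j). j * (2 * n + 1) + (if j \<le> i then i else i + n))"

lemma inj_on_cyclic_key: "inj_on (cyclic_key n) (index_set n m)"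
proof (rule inj_onI, clarify)
  fix i j i' j'
  assume mem: "(i, j) \<in> index_set n m" "(i', j') \<in> index_set n m"
    and eq: "cyclic_key n (i, j) = cyclic_key n (i', j')"
  define u where "u = (if j \<le> i then i else i + n)"
  define u' where "u' = (if j' \<le> i' then i' else i' + n)"
  have lt: "u < 2 * n + 1" "u' < 2 * n + 1"
    using mem by (auto simp: u_def u'_def index_set_def)
  have e: "u + j * (2 * n + 1) = u' + j' * (2 * n + 1)"
    using eq by (simp add: cyclic_key_def u_def u'_def)
  have "(u + j * (2 * n + 1)) div (2 * n + 1) = j" "(u' + j' * (2 * n + 1)) div (2 * n + 1) = j'"
    using lt by (simp_all only: div_mult_self1 div_less)
  then have "j = j'" using e by metis
  moreover have "u = u'" using e \<open>j = j'\<close> by simp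
  ultimately show "i = i' \<and> j = j'"
    using mem by (auto simp: u_def u'_def index_set_def split: if_splits)
qed

lemma linear_orders_need_dim:
  assumes "all_linear_orders_induced n m d"
  shows "min n m - 1 \<le> d"
proof -
  have "induced_in_dim d n m (key_order (index_set n m) (cyclic_key n))"
    using assms linear_order_on_key_order[OF inj_on_cyclic_key]
    unfolding all_linear_orders_induced_def by blast
  then obtain p q where ord:
    "\<And>i j i' j'. i \<in> {1..n} \<Longrightarrow> j \<in> {1..m} \<Longrightarrow> i' \<in> {1..n} \<Longrightarrow> j' \<in> {1..m} \<Longrightarrow>
       sq_dist d (p i) (q j) \<le> sq_dist d (p i') (q j') \<longleftrightarrow> cyclic_key n (i, j) \<le> cyclic_key n (i', j')"
    by (rule induced_key_orderE) blast
  show ?thesis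
  proof (rule cyclic_order_needs_dim[of "min n m" d p q])
    fix i j assume "i \<in> {1..<min n m}" "j \<in> {1..min n m}" "Suc i \<noteq> j"
    then have "\<not> sq_dist d (p (Suc i)) (q j) \<le> sq_dist d (p i) (q j)"
      using ord[of "Suc i" j i j] by (auto simp: cyclic_key_def)
    then show "sq_dist d (p i) (q j) < sq_dist d (p (Suc i)) (q j)" by simp
  next
    fix j assume "j \<in> {1..min n m}" "j \<noteq> 1"
    then have "\<not> sq_dist d (p 1) (q j) \<le> sq_dist d (p (min n m)) (q j)"
      using ord[of 1 j "min n m" j] by (auto simp: cyclic_key_def)
    then show "sq_dist d (p (min n m)) (q j) < sq_dist d (p 1) (q j)" by simp
  qed
qed

lemma total_preorders_need_dim:
  assumes "1 \<le> n" "1 \<le> m" "all_total_preorders_induced n m d"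
  shows "min n m \<le> d"
proof -
  define k where "k = min n m"
  have k: "1 \<le> k" "k \<le> n" "k \<le> m" using assms(1,2) by (auto simp: k_def)
  define f :: "nat \<times> nat \<Rightarrow> nat" where "f = (\<lambda>(i, j). if i = j \<and> i < k then 0 else 1)"
  have "induced_in_dim d n m (key_order (index_set n m) f)"
    using assms(3) total_preorder_on_key_order unfolding all_total_preorders_induced_def by blast
  then obtain p q where ord:
    "\<And>i j i' j'. i \<in> {1..n} \<Longrightarrow> j \<in> {1..m} \<Longrightarrow> i' \<in> {1..n} \<Longrightarrow> j' \<in> {1..m} \<Longrightarrow>
       sq_dist d (p i) (q j) \<le> sq_dist d (p i') (q j') \<longleftrightarrow> f (i, j) \<le> f (i', j')"
    and pos: "\<And>i j. i \<in> {1..n} \<Longrightarrow> j \<in> {1..m} \<Longrightarrow> 0 < sq_dist d (p i) (q j)"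
    by (rule induced_key_orderE) blast
  show ?thesis
    unfolding k_def[symmetric]
  proof (rule broken_diagonal_needs_dim[of k "sq_dist d (p k) (q k)" d p q])
    show "1 \<le> k" "0 < sq_dist d (p k) (q k)"
      using k pos by auto
  next
    fix i j assume "i \<in> {1..k}" "j \<in> {1..k}" "i \<noteq> j \<or> j = k"
    then show "sq_dist d (p i) (q j) = sq_dist d (p k) (q k)"
      using k ord[of i j k k] ord[of k k i j] by (intro antisym) (auto simp: f_def)
  next
    fix j assume "j \<in> {1..<k}"
    then show "sq_dist d (p j) (q j) < sq_dist d (p k) (q k)"
      using k ord[of k k j j] by (auto simp: f_def not_le[symmetric])
  qed
qed

section \<open>Realization near the basis simplex\<close>

lemma exists_quadratic_root:
  fixes a b c :: real
  assumes "a \<noteq> 0" "4 * a * c \<le> b\<^sup>2"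
  shows "\<exists>x. a * x\<^sup>2 + b * x + c = 0"
proof
  have "(sqrt (b\<^sup>2 - 4 * a * c))\<^sup>2 = b\<^sup>2 - 4 * a * c"
    using assms by simp
  then show "a * ((- b + sqrt (b\<^sup>2 - 4 * a * c)) / (2 * a))\<^sup>2
      + b * ((- b + sqrt (b\<^sup>2 - 4 * a * c)) / (2 * a)) + c = 0"
    using assms(1) by (simp add: power2_eq_square field_simps)
qed

text \<open>
  The coordinates of \<open>x\<close> must be \<open>(s - u l) / 2\<close> with \<open>s = \<bar>x\<bar>\<^sup>2\<close>. The bound \<open>1 / k\<close> on the entries of
  \<open>u\<close> keeps the sum of their squares at most \<open>1 / k\<close>, which makes the quadratic equation for \<open>s\<close> solvable.
\<close>

lemma basis_distances_prescribable:
  fixes u :: "nat \<Rightarrow> real"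
  assumes "1 \<le> k" and u: "\<And>l. l < k \<Longrightarrow> 0 \<le> u l \<and> u l \<le> 1 / k"
  obtains x where "\<And>l. k \<le> l \<Longrightarrow> x l = 0"
    and "\<And>h. h < k \<Longrightarrow> sq_dist k (\<lambda>l. if l = h then 1 else 0) x = 1 + u h"
proof -
  define U where "U = (\<Sum>l<k. u l)"
  define V where "V = (\<Sum>l<k. (u l)\<^sup>2)"
  have "0 \<le> U" unfolding U_def using u by (auto intro: sum_nonneg)
  have "V \<le> (\<Sum>l<k. (1 / real k)\<^sup>2)"
    unfolding V_def using u by (intro sum_mono power_mono) auto
  then have V: "k * V \<le> 1"
    using \<open>1 \<le> k\<close> by (simp add: power2_eq_square field_simps)
  have disc: "4 * real k * V \<le> (- (4 + 2 * U))\<^sup>2"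
  proof -
    have "4 * real k * V \<le> 16" using V by linarith
    also have "16 \<le> (- (4 + 2 * U))\<^sup>2"
      using \<open>0 \<le> U\<close> by (simp add: power2_eq_square algebra_simps)
    finally show ?thesis .
  qed
  \<comment> \<open>This is the condition \<open>s = \<bar>x\<bar>\<^sup>2\<close> for the coordinates \<open>(s - u l) / 2\<close>, multiplied by four.\<close>
  obtain s :: real where s: "k * s\<^sup>2 + (- (4 + 2 * U)) * s + V = 0"
    using exists_quadratic_root[OF _ disc] \<open>1 \<le> k\<close> by auto
  define x where "x = (\<lambda>l. if l < k then (s - u l) / 2 else 0)"
  have norm: "(\<Sum>l<k. (x l)\<^sup>2) = s"
  proof -
    have "(\<Sum>l<k. (x l)\<^sup>2) = (\<Sum>l<k. s\<^sup>2 / 4 - s / 2 * u l + (u l)\<^sup>2 / 4)"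
      by (intro sum.cong) (auto simp: x_def power2_eq_square field_simps)
    also have "\<dots> = k * s\<^sup>2 / 4 - s / 2 * U + V / 4"
      by (simp add: sum.distrib sum_subtractf U_def V_def sum_distrib_left sum_divide_distrib)
    also have "\<dots> = s" using s by (simp add: field_simps)
    finally show ?thesis .
  qed
  show thesis
  proof (rule that)
    show "x l = 0" if "k \<le> l" for l using that by (simp add: x_def)
    fix h assume h: "h < k"
    have "sq_dist k (\<lambda>l. if l = h then 1 else 0) x = (\<Sum>l<k. (x l)\<^sup>2 + (if l = h then 1 - 2 * x h else 0))"
      unfolding sq_dist_def by (intro sum.cong) (auto simp: power2_eq_square algebra_simps)
    also have "\<dots> = 1 + u h"
      using h by (simp add: sum.distrib norm) (simp add: x_def field_simps)
    finally show "sq_dist k (\<lambda>l. if l = h then 1 else 0) x = 1 + u h" .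
  qed
qed

lemma distances_prescribable:
  fixes t :: "nat \<Rightarrow> nat \<Rightarrow> real"
  assumes "1 \<le> k"
    and t: "\<And>i j. i \<in> {1..k} \<Longrightarrow> j \<in> {1..m} \<Longrightarrow> 0 \<le> t i j \<and> t i j \<le> 1 / k"
  obtains p q where "\<And>i. i \<in> {1..k} \<Longrightarrow> p i \<in> topspace (Euclidean_space k)"
    and "\<And>j. j \<in> {1..m} \<Longrightarrow> q j \<in> topspace (Euclidean_space k)"
    and "\<And>i j. i \<in> {1..k} \<Longrightarrow> j \<in> {1..m} \<Longrightarrow> sq_dist k (p i) (q j) = 1 + t i j"
proof -
  have "\<exists>x. (\<forall>l\<ge>k. x l = 0) \<and>
      (\<forall>h<k. sq_dist k (\<lambda>l. if l = h then 1 else 0) x = 1 + t (Suc h) j)" if "j \<in> {1..m}" for j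
    using basis_distances_prescribable[OF \<open>1 \<le> k\<close>, of "\<lambda>l. t (Suc l) j"] t that
    by (metis One_nat_def Suc_leI atLeastAtMost_iff le_add1 plus_1_eq_Suc)
  then obtain q where q: "\<And>j. j \<in> {1..m} \<Longrightarrow> (\<forall>l\<ge>k. q j l = 0) \<and>
      (\<forall>h<k. sq_dist k (\<lambda>l. if l = h then 1 else 0) (q j) = 1 + t (Suc h) j)"
    by metis
  show thesis
  proof (rule that[of "\<lambda>i l. if l = i - 1 then 1 else 0" q])
    show "(\<lambda>l. if l = i - 1 then 1 else 0) \<in> topspace (Euclidean_space k)" if "i \<in> {1..k}" for i
      using that by (auto simp: topspace_Euclidean_space)
    show "q j \<in> topspace (Euclidean_space k)" if "j \<in> {1..m}" for j
      using q[OF that] by (simp add: topspace_Euclidean_space)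
    show "sq_dist k (\<lambda>l. if l = i - 1 then 1 else 0) (q j) = 1 + t i j"
      if "i \<in> {1..k}" "j \<in> {1..m}" for i j
      using q[OF that(2)] that(1) by (cases i) auto
  qed
qed

lemma total_preorder_rank:
  assumes "finite A" "total_preorder_on A r" "x \<in> A" "y \<in> A"
  shows "(x, y) \<in> r \<longleftrightarrow> card {z \<in> A. (z, x) \<in> r} \<le> card {z \<in> A. (z, y) \<in> r}"
proof -
  have tr: "trans r" and re: "refl_on A r" and tot: "total_on A r"
    using assms(2) by (auto simp: total_preorder_on_def preorder_on_def)
  show ?thesis
  proof
    assume "(x, y) \<in> r"
    then show "card {z \<in> A. (z, x) \<in> r} \<le> card {z \<in> A. (z, y) \<in> r}"
      using tr assms(1) by (intro card_mono) (auto dest: transD)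
  next
    assume le: "card {z \<in> A. (z, x) \<in> r} \<le> card {z \<in> A. (z, y) \<in> r}"
    show "(x, y) \<in> r"
    proof (rule ccontr)
      assume no: "(x, y) \<notin> r"
      then have "(y, x) \<in> r"
        using tot re assms(3,4) by (metis refl_onD total_on_def)
      then have "{z \<in> A. (z, y) \<in> r} \<subset> {z \<in> A. (z, x) \<in> r}"
        using tr no re assms(3) by (auto dest: transD refl_onD)
      then have "card {z \<in> A. (z, y) \<in> r} < card {z \<in> A. (z, x) \<in> r}"
        using assms(1) by (intro psubset_card_mono) auto
      then show False using le by simp
    qed
  qed
qed

lemma total_preorders_induced:
  assumes "1 \<le> n" "1 \<le> m"
  shows "all_total_preorders_induced n m (min n m)"
  unfolding all_total_preorders_induced_def
proof (intro allI impI)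
  fix r assume r: "total_preorder_on (index_set n m) r"
  define A where "A = index_set n m"
  define k where "k = min n m"
  have k: "1 \<le> k" using assms by (simp add: k_def)
  have A: "finite A" "A \<noteq> {}" using assms by (auto simp: A_def index_set_def)
  then have N: "0 < card A" by (simp add: card_gt_0_iff)
  define \<rho> where "\<rho> = (\<lambda>x. card {z \<in> A. (z, x) \<in> r})"
  \<comment> \<open>Ranks are scaled to lie below \<open>1 / k\<close>.\<close>
  define t where "t = (\<lambda>i j. real (\<rho> (i, j)) / (card A * k))"
  have t_bounds: "0 \<le> t i j \<and> t i j \<le> 1 / k" for i j
  proof -
    have "\<rho> (i, j) \<le> card A"
      unfolding \<rho>_def using A by (intro card_mono) auto
    then show ?thesis using N k by (simp add: t_def field_simps)
  qed
  have t_le: "t i j \<le> t i' j' \<longleftrightarrow> \<rho> (i, j) \<le> \<rho> (i', j')" for i j i' j'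
    using N k by (simp add: t_def divide_le_cancel mult_less_0_iff)
  obtain p q where
    p: "\<And>i. i \<in> {1..n} \<Longrightarrow> p i \<in> topspace (Euclidean_space k)" and
    q: "\<And>j. j \<in> {1..m} \<Longrightarrow> q j \<in> topspace (Euclidean_space k)" and
    pq: "\<And>i j. i \<in> {1..n} \<Longrightarrow> j \<in> {1..m} \<Longrightarrow> sq_dist k (p i) (q j) = 1 + t i j"
  proof (cases "n \<le> m")
    case True
    then have "k = n" by (simp add: k_def)
    then show ?thesis
      using distances_prescribable[OF k, of m t] t_bounds that by blast
  next
    case False
    then have km: "k = m" by (simp add: k_def)
    obtain p' q' where "\<And>i. i \<in> {1..k} \<Longrightarrow> p' i \<in> topspace (Euclidean_space k)"
      "\<And>j. j \<in> {1..n} \<Longrightarrow> q' j \<in> topspace (Euclidean_space k)"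
      "\<And>i j. i \<in> {1..k} \<Longrightarrow> j \<in> {1..n} \<Longrightarrow> sq_dist k (p' i) (q' j) = 1 + t j i"
      using distances_prescribable[OF k, of n "\<lambda>i j. t j i"] t_bounds by blast
    then show ?thesis
      using that[of q' p'] unfolding km by (simp add: sq_dist_commute)
  qed
  have "p i \<noteq> q j" if "i \<in> {1..n}" "j \<in> {1..m}" for i j
  proof
    assume "p i = q j"
    then have "1 + t i j = 0" using pq[OF that] by simp
    then show False using t_bounds[of i j] by linarith
  qed
  then have "point_collections k n m p q"
    using p q by (auto simp: point_collections_def)
  moreover have "r = distance_preorder k n m p q"
  proof -
    have "r \<subseteq> A \<times> A"
      using r by (simp add: A_def total_preorder_on_def preorder_on_def)
    moreover have "((i, j), (i', j')) \<in> r \<longleftrightarrow> eucl_dist k (p i) (q j) \<le> eucl_dist k (p i') (q j')"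
      if "(i, j) \<in> A" "(i', j') \<in> A" for i j i' j'
      using total_preorder_rank[OF A(1) r[folded A_def] that] that
      by (simp add: eucl_dist_eq_sqrt pq A_def index_set_def t_le \<rho>_def)
    ultimately show ?thesis
      unfolding distance_preorder_def A_def by auto
  qed
  ultimately show "induced_in_dim (min n m) n m r"
    unfolding induced_in_dim_def k_def by blast
qed

lemma all_linear_orders_induced_if_total_preorders:
  "all_total_preorders_induced n m d \<Longrightarrow> all_linear_orders_induced n m d"
  by (simp add: all_linear_orders_induced_def all_total_preorders_induced_def
      linear_order_on_def partial_order_on_def total_preorder_on_def)

theorem theorem2:
  fixes n m :: nat
  assumes "n \<ge> 2" and "m \<ge> 1"
  shows "((\<exists>d. all_linear_orders_induced n m d) \<and>
          min n m - 1 \<le> (LEAST d. all_linear_orders_induced n m d) \<and>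
          (LEAST d. all_linear_orders_induced n m d) \<le> min n m) \<and>
         ((\<exists>d. all_total_preorders_induced n m d) \<and>
          (LEAST d. all_total_preorders_induced n m d) = min n m)"
proof -
  have nm: "1 \<le> n" "1 \<le> m" using assms by auto
  have pre: "all_total_preorders_induced n m (min n m)"
    by (rule total_preorders_induced[OF nm])
  have lin: "all_linear_orders_induced n m (min n m)"
    by (rule all_linear_orders_induced_if_total_preorders[OF pre])
  have "min n m - 1 \<le> (LEAST d. all_linear_orders_induced n m d)"
    by (rule linear_orders_need_dim) (rule LeastI, rule lin)
  moreover have "(LEAST d. all_linear_orders_induced n m d) \<le> min n m"
    by (rule Least_le) (rule lin)
  moreover have "(LEAST d. all_total_preorders_induced n m d) = min n m"
    by (rule Least_equality) (use pre total_preorders_need_dim[OF nm] in auto)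
  ultimately show ?thesis using pre lin by blast
qed

end
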